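(* There exists an absolute constant $C>0$ such that for all integers $\Delta\ge 2$, $D\ge 1$ and $0\le k<D$ there is a port-labeled rooted tree $T$ of height $D$ with maximum degree $\Delta$ and root $r$ with the following property. For every deterministic algorithm $\mathcal{A}$ for the agent and every pebble placement strategy $\mathcal{L}$, which assigns to each node $t$ of $T$ with $\mathrm{dist}(r,t)=D$ (the position of the treasure) a placement of at most $k$ pebbles on nodes of $T$ (at most one per node), there is a node $t$ of $T$ with $\mathrm{dist}(r,t)=D$ such that the agent, starting at $r$ and executing $\mathcal{A}$ in $T$ with treasure at $t$ and pebbles placed according to $\mathcal{L}(t)$, needs time at least $$C\left(\frac{k}{e}\right)^{\frac{k}{k+1}}(\Delta-1)^{\frac{D}{k+1}}$$ to find the treasure (possibly never finding it). That is, any deterministic algorithm requires $\Omega\left(\left(\frac{k}{e}\right)^{\frac{k}{k+1}}(\Delta-1)^{\frac{D}{k+1}}\right)$ time for treasure hunt using at most $k$ pebbles placed on the nodes of $T$. (For $k=0$ the factor $(k/e)^{k/(k+1)}$ is read as $1$.)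
   Context: Treasure hunt model. The environment is a finite simple undirected connected graph (here a tree $T$) whose nodes are anonymous (unlabeled). At each node $u$, the incident edges carry distinct port numbers $0,1,\dots,\deg(u)-1$, in a fixed order; each edge thus has two port numbers, one at each endpoint. $\mathrm{dist}(u,v)$ is the number of edges on a shortest path between $u$ and $v$. A mobile agent starts at a given node (here the root $r$); a stationary treasure is at a node $t$ at distance $D$ from the starting node. An oracle, which knows the graph with its port labels, the starting node and $t$, places pebbles (indistinguishable from each other) on nodes, at most one per node, before the agent starts. When at a node, the agent sees the degree of that node, whether a pebble is there, and whether the treasure is there; when it traverses an edge (by choosing a port at its current node), it learns the outgoing port used and the incoming port at the node it arrives at. It has unbounded memory. A deterministic algorithm for the agent chooses each next port as a function of the history of everything the agent has observed so far. The time of treasure hunt is the number of edge traversals made by the agent until it first reaches $t$. The height of a rooted tree is the maximum distance from the root to a node. *)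

theory Defs
  imports Complex_Main "HOL-Library.Extended_Real" "Graph_Theory.Graph_Theory"
begin

text \<open>
  A finite simple undirected graph is a symmetric loop-free finite digraph without parallel
  arcs, i.e. \<^locale>\<open>pair_graph\<close>: an edge is a pair of opposite arcs, and the degree of a
  node is its out-degree.
\<close>

text \<open>
  The library's \<^const>\<open>tree\<close> forbids all directed cycles, in particular the 2-cycles formed
  by the two arcs of a single undirected edge, so it has no symmetric instance with an edge.
  The cycles of an undirected simple graph are the directed cycles of length at least 3.
\<close>
definition undirected_tree :: "'v pair_pre_digraph \<Rightarrow> bool" where
  "undirected_tree G \<longleftrightarrow> pair_graph G \<and> connected (with_proj G) \<and>
     \<not> (\<exists>p. pre_digraph.cycle (with_proj G) p \<and> length p \<ge> 3)"

abbreviation node_degree :: "'v pair_pre_digraph \<Rightarrow> 'v \<Rightarrow> nat" where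
  "node_degree G u \<equiv> out_degree (with_proj G) u"

definition max_degree :: "'v pair_pre_digraph \<Rightarrow> nat" where
  "max_degree G = Max (node_degree G ` pverts G)"

definition hop_dist :: "'v pair_pre_digraph \<Rightarrow> 'v \<Rightarrow> 'v \<Rightarrow> ereal" where
  "hop_dist G u v = wf_digraph.\<mu> (with_proj G) (\<lambda>_. 1) u v"

definition height :: "'v pair_pre_digraph \<Rightarrow> 'v \<Rightarrow> ereal" where
  "height G r = Max (hop_dist G r ` pverts G)"

text \<open>The value \<open>\<pi> u v\<close> is the port number at \<open>u\<close> of the edge between \<open>u\<close> and \<open>v\<close>.\<close>
definition port_labeling :: "'v pair_pre_digraph \<Rightarrow> ('v \<Rightarrow> 'v \<Rightarrow> nat) \<Rightarrow> bool" where
  "port_labeling G \<pi> \<longleftrightarrow>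
     (\<forall>u\<in>pverts G. bij_betw (\<pi> u) {v. (u, v) \<in> parcs G} {..<node_degree G u})"

definition port_target :: "'v pair_pre_digraph \<Rightarrow> ('v \<Rightarrow> 'v \<Rightarrow> nat) \<Rightarrow> 'v \<Rightarrow> nat \<Rightarrow> 'v" where
  "port_target G \<pi> u p = (THE v. (u, v) \<in> parcs G \<and> \<pi> u v = p)"

record observation =
  obs_degree :: nat
  obs_pebble :: bool
  obs_treasure :: bool

text \<open>
  \<open>Move h p q ob\<close> extends the history \<open>h\<close> by a traversal that leaves through port \<open>p\<close>,
  arrives through port \<open>q\<close>, and observes \<open>ob\<close> at the node reached. Histories contain no
  node identities, so an algorithm cannot depend on them.
\<close>
datatype history = Start observation | Move history nat nat observation

fun last_observation :: "history \<Rightarrow> observation" where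
  "last_observation (Start ob) = ob"
| "last_observation (Move h p q ob) = ob"

type_synonym algorithm = "history \<Rightarrow> nat"

text \<open>An algorithm must choose a port that exists at the current node.\<close>
definition valid_algorithm :: "algorithm \<Rightarrow> bool" where
  "valid_algorithm A \<longleftrightarrow>
     (\<forall>h. obs_degree (last_observation h) > 0 \<longrightarrow> A h < obs_degree (last_observation h))"

definition observe :: "'v pair_pre_digraph \<Rightarrow> 'v set \<Rightarrow> 'v \<Rightarrow> 'v \<Rightarrow> observation" where
  "observe G P t u =
     \<lparr>obs_degree = node_degree G u, obs_pebble = (u \<in> P), obs_treasure = (u = t)\<rparr>"

text \<open>
  The node and history of the agent after \<open>n\<close> edge traversals, when executing \<open>A\<close> from \<open>r\<close>
  with treasure at \<open>t\<close> and pebbles on the nodes in \<open>P\<close>. The run is continued after \<open>t\<close> has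
  been reached, which does not affect the time of the first visit to \<open>t\<close>.
\<close>
primrec run :: "'v pair_pre_digraph \<Rightarrow> ('v \<Rightarrow> 'v \<Rightarrow> nat) \<Rightarrow> algorithm \<Rightarrow> 'v set \<Rightarrow> 'v \<Rightarrow> 'v \<Rightarrow>
    nat \<Rightarrow> 'v \<times> history" where
  "run G \<pi> A P r t 0 = (r, Start (observe G P t r))"
| "run G \<pi> A P r t (Suc n) =
     (let (u, h) = run G \<pi> A P r t n; p = A h; v = port_target G \<pi> u p
      in (v, Move h p (\<pi> v u) (observe G P t v)))"

text \<open>The value is \<open>\<infinity>\<close> if the agent never reaches \<open>t\<close>.\<close>
definition hunt_time :: "'v pair_pre_digraph \<Rightarrow> ('v \<Rightarrow> 'v \<Rightarrow> nat) \<Rightarrow> algorithm \<Rightarrow> 'v set \<Rightarrow>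
    'v \<Rightarrow> 'v \<Rightarrow> enat" where
  "hunt_time G \<pi> A P r t = (INF n\<in>{n. fst (run G \<pi> A P r t n) = t}. enat n)"

definition pebble_strategy :: "'v pair_pre_digraph \<Rightarrow> 'v \<Rightarrow> nat \<Rightarrow> nat \<Rightarrow> ('v \<Rightarrow> 'v set) \<Rightarrow> bool" where
  "pebble_strategy G r D k L \<longleftrightarrow>
     (\<forall>t\<in>pverts G. hop_dist G r t = ereal (real D) \<longrightarrow> L t \<subseteq> pverts G \<and> card (L t) \<le> k)"

end

theory Submission
  imports Defs
begin

text \<open>
  Until the treasure is found, the run of an agent on a known graph depends only on the bits
  telling at each step whether the current node carries a pebble, and these bits can be recovered
  from the set of times at which a pebbled node is visited for the first time. These at most
  \<open>k\<close> times together with the time at which the treasure is found form a set of at most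
  \<open>k + 1\<close> times that determines the position of the treasure. So if every treasure at depth
  \<open>D\<close> is found in fewer than \<open>n\<close> steps, then the number of such positions is at most
  \<open>\<Sum>i\<le>k+1. n choose i \<le> (e n / (k + 1)) ^ (k + 1)\<close>. A tree with at least
  \<open>(\<Delta> - 1) ^ D\<close> nodes at depth \<open>D\<close>, with any port labeling, gives the bound.
\<close>

section \<open>Encoding a run by the times of its discoveries\<close>

text \<open>Only first visits count, so each pebble contributes at most one time; the walk
  \<open>w\<close> itself tells which later visits return to the same node.\<close>

definition discovery_times :: "(nat \<Rightarrow> 'v) \<Rightarrow> 'v set \<Rightarrow> nat \<Rightarrow> nat set" where
  "discovery_times w P n = {i. i < n \<and> w i \<in> P \<and> (\<forall>j<i. w j \<noteq> w i)}"

lemma discovery_times_subset: "discovery_times w P n \<subseteq> {..<n}"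
  by (auto simp: discovery_times_def)

lemma card_discovery_times_le:
  assumes "finite P"
  shows "card (discovery_times w P n) \<le> card P"
proof (rule card_inj_on_le[OF _ _ assms])
  show "inj_on w (discovery_times w P n)"
    by (auto simp: inj_on_def discovery_times_def) (metis linorder_neqE_nat)
qed (auto simp: discovery_times_def)

text \<open>The first visit to the node \<open>w i\<close> happens no later than \<open>i\<close>.
  The right-hand side therefore reads \<open>w\<close> only up to time \<open>i\<close>, which lets
  \<open>run_eqI\<close> use it in an induction over time.\<close>

lemma visits_pebble_iff:
  assumes "i < n"
  shows "w i \<in> P \<longleftrightarrow> (\<exists>j\<in>discovery_times w P n. j \<le> i \<and> w j = w i)"
proof
  assume "w i \<in> P"
  define j where "j = (LEAST j. w j = w i)"
  have "w j = w i" unfolding j_def by (rule LeastI) simp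
  moreover have "j \<le> i" unfolding j_def by (rule Least_le) simp
  moreover have "w l \<noteq> w i" if "l < j" for l
    using that not_less_Least unfolding j_def by blast
  ultimately show "\<exists>j\<in>discovery_times w P n. j \<le> i \<and> w j = w i"
    using \<open>w i \<in> P\<close> assms by (intro bexI[of _ j]) (auto simp: discovery_times_def)
qed (auto simp: discovery_times_def)

text \<open>Strong induction on time: the past run fixes the current node, the discovery times then
  fix its pebble bit, and the treasure bit is false in both runs before time
  \<open>n\<close>.\<close>

lemma run_eqI:
  fixes G :: "'v pair_pre_digraph"
  defines "w \<equiv> \<lambda>P t i (A :: algorithm) \<pi> r. fst (run G \<pi> A P r t i)"
  assumes disc: "discovery_times (\<lambda>i. w P t i A \<pi> r) P n = discovery_times (\<lambda>i. w P' t' i A \<pi> r) P' n"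
    and t: "\<And>i. i < n \<Longrightarrow> w P t i A \<pi> r \<noteq> t"
    and t': "\<And>i. i < n \<Longrightarrow> w P' t' i A \<pi> r \<noteq> t'"
    and i: "i < n"
  shows "run G \<pi> A P r t i = run G \<pi> A P' r t' i"
  using i
proof (induction i rule: less_induct)
  case (less i)
  have same: "run G \<pi> A P r t j = run G \<pi> A P' r t' j" if "j < i" for j
    using less that by auto
  have pos: "w P t i A \<pi> r = w P' t' i A \<pi> r"
    by (cases i) (auto simp: w_def Let_def same split: prod.splits)
  have "w P t i A \<pi> r \<in> P \<longleftrightarrow> w P' t' i A \<pi> r \<in> P'"
  proof -
    have "w P t j A \<pi> r = w P' t' j A \<pi> r" if "j \<le> i" for j
      using same[of j] pos that by (cases "j = i") (auto simp: w_def)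
    then show ?thesis
      using visits_pebble_iff[OF less.prems, of "\<lambda>i. w P t i A \<pi> r" P]
        visits_pebble_iff[OF less.prems, of "\<lambda>i. w P' t' i A \<pi> r" P']
      by (auto simp: disc)
  qed
  then have obs: "observe G P t (w P t i A \<pi> r) = observe G P' t' (w P' t' i A \<pi> r)"
    using pos t[OF less.prems] t'[OF less.prems] by (simp add: observe_def)
  show ?case
  proof (cases i)
    case 0
    then show ?thesis using obs by (simp add: w_def)
  next
    case (Suc j)
    then show ?thesis using obs same[of j] by (auto simp: w_def Let_def split: prod.splits)
  qed
qed

text \<open>The code \<open>f t\<close>, the finding time together with the earlier discovery times,
  is injective on \<open>X\<close> and is a subset of \<open>{..<n}\<close> with at most
  \<open>k + 1\<close> elements.\<close>

lemma card_targets_le: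
  fixes G :: "'v pair_pre_digraph"
  assumes L: "\<And>t. t \<in> X \<Longrightarrow> finite (L t) \<and> card (L t) \<le> k"
    and found: "\<And>t. t \<in> X \<Longrightarrow> \<exists>i<n. fst (run G \<pi> A (L t) r t i) = t"
  shows "card X \<le> (\<Sum>i\<le>k + 1. n choose i)"
proof -
  define w where "w t i = fst (run G \<pi> A (L t) r t i)" for t i
  define \<tau> where "\<tau> t = (LEAST i. w t i = t)" for t
  define f where "f t = insert (\<tau> t) (discovery_times (w t) (L t) (\<tau> t))" for t
  have before: "w t i \<noteq> t" if "i < \<tau> t" for t i
    using that not_less_Least unfolding \<tau>_def by blast
  have at: "w t (\<tau> t) = t" "\<tau> t < n" if t: "t \<in> X" for t
  proof -
    obtain i where i: "i < n" "w t i = t" using found[OF t] by (auto simp: w_def)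
    show "w t (\<tau> t) = t" unfolding \<tau>_def using i(2) by (rule LeastI)
    show "\<tau> t < n" using i unfolding \<tau>_def by (meson Least_le le_less_trans)
  qed
  have "inj_on f X"
  proof (rule inj_onI)
    fix t t' assume X: "t \<in> X" "t' \<in> X" and ff: "f t = f t'"
    \<comment> \<open>All discovery times in the code lie strictly below \<open>\<tau> t\<close>, so
      the finding time can be read off as the maximum even if the treasure node carries a
      pebble.\<close>
    have Max_f: "Max (f t) = \<tau> t" and diff: "f t - {\<tau> t} = discovery_times (w t) (L t) (\<tau> t)" for t
    proof -
      have sub: "discovery_times (w t) (L t) (\<tau> t) \<subseteq> {..<\<tau> t}"
        by (rule discovery_times_subset)
      show "Max (f t) = \<tau> t"
        unfolding f_def using sub by (intro Max_eqI) (auto intro: finite_subset)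
      show "f t - {\<tau> t} = discovery_times (w t) (L t) (\<tau> t)"
        unfolding f_def using sub by auto
    qed
    have \<tau>: "\<tau> t' = \<tau> t" using Max_f[of t] Max_f[of t'] ff by simp
    have disc: "discovery_times (w t) (L t) (\<tau> t) = discovery_times (w t') (L t') (\<tau> t)"
      using diff[of t] diff[of t'] ff \<tau> by simp
    have same: "run G \<pi> A (L t) r t i = run G \<pi> A (L t') r t' i" if "i < \<tau> t" for i
      using run_eqI[where n = "\<tau> t" and P = "L t" and P' = "L t'" and t = t and t' = t' and i = i
          and G = G and A = A and r = r and \<pi> = \<pi>]
        before[of _ t] before[of _ t'] disc \<tau> that
      unfolding w_def by auto
    \<comment> \<open>The node at time \<open>\<tau> t\<close> is determined by the run one step
      earlier, or is the start \<open>r\<close> at time 0. In the two runs it is \<open>t\<close>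
      and \<open>t'\<close>.\<close>
    have "w t (\<tau> t) = w t' (\<tau> t)"
      by (cases "\<tau> t") (auto simp: w_def Let_def same split: prod.splits)
    then show "t = t'" using at(1)[OF X(1)] at(1)[OF X(2)] \<tau> by simp
  qed
  moreover have "f ` X \<subseteq> (\<Union>i\<le>k + 1. {S. S \<subseteq> {..<n} \<and> card S = i})"
  proof
    fix S assume "S \<in> f ` X"
    then obtain t where t: "t \<in> X" "S = f t" by auto
    have "card S \<le> Suc (card (discovery_times (w t) (L t) (\<tau> t)))"
      unfolding t(2) f_def by (rule card_insert_le_m1) simp_all
    also have "\<dots> \<le> k + 1"
      using card_discovery_times_le[of "L t" "w t" "\<tau> t"] L[OF t(1)] by simp
    finally have "card S \<le> k + 1" .
    moreover have "S \<subseteq> {..<n}"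
      using discovery_times_subset[of "w t" "L t" "\<tau> t"] at(2)[OF t(1)] unfolding t(2) f_def
      by fastforce
    ultimately show "S \<in> (\<Union>i\<le>k + 1. {S. S \<subseteq> {..<n} \<and> card S = i})" by auto
  qed
  ultimately have "card X \<le> card (\<Union>i\<le>k + 1. {S. S \<subseteq> {..<n} \<and> card S = i})"
    by (intro card_inj_on_le) auto
  also have "\<dots> \<le> (\<Sum>i\<le>k + 1. card {S. S \<subseteq> {..<n} \<and> card S = i})"
    by (rule card_UN_le) simp
  also have "\<dots> = (\<Sum>i\<le>k + 1. n choose i)"
    by (simp add: n_subsets)
  finally show ?thesis .
qed

section \<open>Partial sums of binomial coefficients\<close>

lemma sum_choose_le_exp:
  assumes "1 \<le> m" "m \<le> n"
  shows "real (\<Sum>i\<le>m. n choose i) \<le> (exp 1 * real n / real m) ^ m"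
proof -
  \<comment> \<open>Since \<open>x \<le> 1\<close>, replacing \<open>x ^ m\<close> by
    \<open>x ^ i\<close> for \<open>i \<le> m\<close> only increases the sum, which then extends to
    the full expansion of \<open>(x + 1) ^ n\<close>. The choice \<open>x = m / n\<close> turns
    \<open>exp x ^ n\<close> into \<open>exp 1 ^ m\<close>.\<close>
  define x where "x = real m / real n"
  have x: "0 < x" "x \<le> 1" using assms by (auto simp: x_def)
  have "x ^ m * real (\<Sum>i\<le>m. n choose i) = (\<Sum>i\<le>m. real (n choose i) * x ^ m)"
    by (simp add: sum_distrib_left mult.commute)
  also have "\<dots> \<le> (\<Sum>i\<le>m. real (n choose i) * x ^ i)"
    using x by (intro sum_mono mult_left_mono power_decreasing) auto
  also have "\<dots> \<le> (\<Sum>i\<le>n. real (n choose i) * x ^ i)"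
    using assms x by (intro sum_mono2) auto
  also have "\<dots> = (x + 1) ^ n"
    by (simp add: binomial_ring)
  also have "\<dots> \<le> exp x ^ n"
    using x exp_ge_add_one_self[of x] by (intro power_mono) (auto simp: add.commute)
  also have "\<dots> = exp 1 ^ m"
    using assms by (simp add: x_def flip: exp_of_nat_mult)
  finally have "real (\<Sum>i\<le>m. n choose i) \<le> exp 1 ^ m / x ^ m"
    using x by (simp add: field_simps)
  also have "\<dots> = (exp 1 * real n / real m) ^ m"
    by (simp add: x_def power_divide power_mult_distrib)
  finally show ?thesis .
qed

lemma hunt_time_less_iff:
  "hunt_time G \<pi> A P r t < enat n \<longleftrightarrow> (\<exists>i<n. fst (run G \<pi> A P r t i) = t)"
  unfolding hunt_time_def INF_less_iff by auto

section \<open>Runs on port-labeled graphs\<close>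

lemma (in pair_wf_digraph) node_degree_conv: "node_degree G u = card {v. (u, v) \<in> parcs G}"
proof -
  have "out_arcs (with_proj G) u = Pair u ` {v. (u, v) \<in> parcs G}"
    by (auto simp: out_arcs_def)
  then show ?thesis
    unfolding out_degree_def by (simp add: card_image inj_on_def)
qed

lemma (in pair_fin_digraph) ex_port_labeling: "\<exists>\<pi>. port_labeling G \<pi>"
proof -
  have "\<forall>u. \<exists>f. bij_betw f {v. (u, v) \<in> parcs G} {..<node_degree G u}"
  proof
    fix u
    have "{v. (u, v) \<in> parcs G} \<subseteq> pverts G" by (auto dest: in_arcsD2)
    then have "finite {v. (u, v) \<in> parcs G}"
      using pair_finite_verts by (rule finite_subset)
    then show "\<exists>f. bij_betw f {v. (u, v) \<in> parcs G} {..<node_degree G u}"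
      by (rule finite_same_card_bij) (simp_all add: node_degree_conv)
  qed
  from choice[OF this] show ?thesis by (auto simp: port_labeling_def)
qed

lemma port_target_arc:
  assumes "port_labeling G \<pi>" "u \<in> pverts G" "p < node_degree G u"
  shows "(u, port_target G \<pi> u p) \<in> parcs G"
proof -
  have bij: "bij_betw (\<pi> u) {v. (u, v) \<in> parcs G} {..<node_degree G u}"
    using assms by (auto simp: port_labeling_def)
  then have "p \<in> \<pi> u ` {v. (u, v) \<in> parcs G}"
    using assms(3) by (simp add: bij_betw_def)
  then have "\<exists>v. (u, v) \<in> parcs G \<and> \<pi> u v = p"
    by auto
  moreover have "v = v'" if "(u, v) \<in> parcs G \<and> \<pi> u v = p" "(u, v') \<in> parcs G \<and> \<pi> u v' = p" for v v'
    using bij that by (auto simp: bij_betw_def inj_on_def)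
  ultimately have "\<exists>!v. (u, v) \<in> parcs G \<and> \<pi> u v = p" by blast
  from theI'[OF this] show ?thesis by (simp add: port_target_def)
qed

lemma last_observation_run:
  "last_observation (snd (run G \<pi> A P r t n)) = observe G P t (fst (run G \<pi> A P r t n))"
  by (cases n) (auto simp: Let_def split: prod.splits)

text \<open>\<open>valid_algorithm\<close> constrains the chosen port only at nodes of positive
  degree, hence \<open>pos\<close>. The lemma makes the agent's trajectory a walk, so that its depth
  can be bounded by the elapsed time.\<close>

lemma (in pair_wf_digraph) run_walk:
  assumes "port_labeling G \<pi>" "valid_algorithm A" "r \<in> pverts G"
    and pos: "\<And>u. u \<in> pverts G \<Longrightarrow> node_degree G u > 0"
  shows "fst (run G \<pi> A P r t n) \<in> pverts G"
    and "(fst (run G \<pi> A P r t n), fst (run G \<pi> A P r t (Suc n))) \<in> parcs G"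
proof -
  have step: "(fst (run G \<pi> A P r t n), fst (run G \<pi> A P r t (Suc n))) \<in> parcs G"
    if "fst (run G \<pi> A P r t n) \<in> pverts G" for n
  proof -
    obtain u h where uh: "run G \<pi> A P r t n = (u, h)" by fastforce
    then have u: "u \<in> pverts G" using that by simp
    have "last_observation h = observe G P t u"
      using last_observation_run[of G \<pi> A P r t n] uh by simp
    then have "A h < node_degree G u"
      using assms(2) pos[OF u] unfolding valid_algorithm_def observe_def
      by (metis observation.select_convs(1))
    then show ?thesis
      using port_target_arc[OF assms(1) u] uh by (simp add: Let_def)
  qed
  have in_verts: "fst (run G \<pi> A P r t n) \<in> pverts G" for n
  proof (induction n)
    case (Suc n)
    then show ?case using step in_arcsD2 by blast
  qed (simp add: assms(3))
  show "fst (run G \<pi> A P r t n) \<in> pverts G"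
    by (rule in_verts)
  show "(fst (run G \<pi> A P r t n), fst (run G \<pi> A P r t (Suc n))) \<in> parcs G"
    by (rule step[OF in_verts])
qed

section \<open>Trees given by a parent function\<close>

text \<open>The depth function makes iterated parents end at \<open>r\<close> and rules out cycles.
  The value \<open>par r\<close> is arbitrary, so the arcs of \<open>T\<close> are guarded against
  it.\<close>

locale parent_tree =
  fixes V :: "'v set" and r :: 'v and par :: "'v \<Rightarrow> 'v" and dep :: "'v \<Rightarrow> nat"
  assumes finite_V: "finite V"
    and root_in: "r \<in> V"
    and dep_root: "dep r = 0"
    and par_in: "\<And>v. v \<in> V \<Longrightarrow> v \<noteq> r \<Longrightarrow> par v \<in> V"
    and dep_par: "\<And>v. v \<in> V \<Longrightarrow> v \<noteq> r \<Longrightarrow> dep v = Suc (dep (par v))"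
begin

definition T :: "'v pair_pre_digraph" where
  "T = \<lparr>pverts = V, parcs = {(u, v). u \<in> V \<and> v \<in> V \<and> (u \<noteq> r \<and> par u = v \<or> v \<noteq> r \<and> par v = u)}\<rparr>"

lemma pverts_T [simp]: "pverts T = V"
  by (simp add: T_def)

lemma parcs_T_iff:
  "(u, v) \<in> parcs T \<longleftrightarrow> u \<in> V \<and> v \<in> V \<and> (u \<noteq> r \<and> par u = v \<or> v \<noteq> r \<and> par v = u)"
  by (simp add: T_def)

lemma dep_arc: "(u, v) \<in> parcs T \<Longrightarrow> dep u = Suc (dep v) \<or> dep v = Suc (dep u)"
  by (auto simp: parcs_T_iff dep_par)

sublocale T: pair_graph T
proof unfold_locales
  show "finite (parcs T)"
    by (rule finite_subset[of _ "V \<times> V"]) (auto simp: T_def finite_V)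
  show "symmetric (with_proj T)"
    by (auto simp: symmetric_def sym_def parcs_T_iff)
  show "fst e \<noteq> snd e" if "e \<in> parcs T" for e
    using that dep_arc[of "fst e" "snd e"] by auto
qed (auto simp: T_def finite_V)

lemma node_degree_T:
  assumes "u \<in> V"
  shows "node_degree T u = card {v \<in> V. v \<noteq> r \<and> par v = u} + (if u = r then 0 else 1)"
proof -
  have "{v. (u, v) \<in> parcs T} = {v \<in> V. v \<noteq> r \<and> par v = u} \<union> (if u = r then {} else {par u})"
    using assms by (auto simp: parcs_T_iff par_in)
  \<comment> \<open>If the parent of \<open>u\<close> were also its child, each would be one level
    deeper than the other.\<close>
  moreover have "par u \<notin> {v \<in> V. v \<noteq> r \<and> par v = u}" if "u \<noteq> r"
    using dep_par[of "par u"] dep_par[of u] that assms by auto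
  ultimately show ?thesis
    by (auto simp: T.node_degree_conv finite_V)
qed

section \<open>Distances from the root\<close>

lemma ex_walk_from_root: "v \<in> V \<Longrightarrow> \<exists>p. T.awalk r p v \<and> length p = dep v"
proof (induction "dep v" arbitrary: v)
  case 0
  then have "v = r" using dep_par by fastforce
  then show ?case using root_in dep_root by (intro exI[of _ "[]"]) (simp add: T.awalk_Nil_iff)
next
  case (Suc n)
  then have "v \<noteq> r" using dep_root by auto
  with Suc obtain p where p: "T.awalk r p (par v)" "length p = n"
    using dep_par par_in by (metis nat.inject)
  have "(par v, v) \<in> parcs T" using Suc.prems \<open>v \<noteq> r\<close> par_in by (auto simp: parcs_T_iff)
  then have "T.awalk (par v) [(par v, v)] v"
    by (simp add: T.awalk_Cons_iff T.awalk_Nil_iff Suc.prems)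
  from T.awalk_appendI[OF p(1) this] show ?case
    using p(2) Suc.hyps(2) by (intro exI[of _ "p @ [(par v, v)]"]) simp
qed

text \<open>An arc changes the depth by exactly one. Started at the root, this shows that no walk
  beats the one of length \<open>dep v\<close> along the parents.\<close>

lemma dep_le_length: "T.awalk u p v \<Longrightarrow> dep v \<le> dep u + length p"
proof (induction p arbitrary: u)
  case Nil
  then show ?case by (simp add: T.awalk_Nil_iff)
next
  case (Cons e p)
  then have "e \<in> parcs T" "fst e = u" "T.awalk (snd e) p v" by (auto simp: T.awalk_Cons_iff)
  with Cons.IH[of "snd e"] dep_arc[of "fst e" "snd e"] show ?case by auto
qed

lemma hop_dist_root:
  assumes "v \<in> V"
  shows "hop_dist T r v = ereal (real (dep v))"
proof (rule antisym)
  have cost: "T.awalk_cost (\<lambda>_. 1) p = real (length p)" for p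
    by (induction p) auto
  obtain p where p: "T.awalk r p v" "length p = dep v"
    using ex_walk_from_root[OF assms] by auto
  show "hop_dist T r v \<le> ereal (real (dep v))"
    using T.min_cost_le_walk_cost[OF p(1), of "\<lambda>_. 1"] p(2) by (simp add: hop_dist_def cost)
  show "ereal (real (dep v)) \<le> hop_dist T r v"
    unfolding hop_dist_def T.\<mu>_def
    by (rule INF_greatest) (use dep_le_length[of r _ v] dep_root in \<open>auto simp: cost\<close>)
qed

lemma height_T: "height T r = ereal (real (Max (dep ` V)))"
proof -
  have "height T r = Max ((\<lambda>n. ereal (real n)) ` dep ` V)"
    unfolding height_def by (simp add: image_image hop_dist_root cong: image_cong)
  also have "\<dots> = ereal (real (Max (dep ` V)))"
    using finite_V root_in by (intro mono_Max_commute[symmetric]) (auto simp: mono_def)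
  finally show ?thesis .
qed

section \<open>Connectedness and absence of long cycles\<close>

lemma connected_T: "connected (with_proj T)"
  unfolding connected_def
proof (rule strongly_connectedI)
  show "verts (with_proj (mk_symmetric (with_proj T))) \<noteq> {}"
    using root_in by auto
  fix u v assume "u \<in> verts (with_proj (mk_symmetric (with_proj T)))"
    "v \<in> verts (with_proj (mk_symmetric (with_proj T)))"
  then have uv: "u \<in> V" "v \<in> V" by auto
  have reach: "r \<rightarrow>\<^sup>*\<^bsub>with_proj T\<^esub> w" if "w \<in> V" for w
    using ex_walk_from_root[OF that] T.reachable_awalk by blast
  have "u \<rightarrow>\<^sup>*\<^bsub>with_proj T\<^esub> r"
    using reach[OF uv(1)] symmetric_reachable[OF T.sym_arcs] by simp
  then have "u \<rightarrow>\<^sup>*\<^bsub>with_proj T\<^esub> v"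
    using reach[OF uv(2)] T.reachable_trans by blast
  then show "u \<rightarrow>\<^sup>*\<^bsub>with_proj (mk_symmetric (with_proj T))\<^esub> v"
    by (rule T.reachable_mk_symmetricI)
qed

lemma walk_consecutive:
  assumes "pcas u p v" "i < length p"
  shows "fst (p ! i) = (if i = 0 then u else snd (p ! (i - 1)))"
  using assms
proof (induction p arbitrary: u i)
  case (Cons e p)
  then show ?case by (cases i) (auto simp: nth_Cons split: nat.split)
qed simp

text \<open>Both neighbors, on the cycle, of a deepest node of the cycle are the parent of that node.\<close>

lemma no_long_cycle:
  assumes "T.cycle p"
  shows "length p < 3"
proof (rule ccontr)
  define n where "n = length p"
  assume "\<not> length p < 3"
  then have n: "3 \<le> n" by (simp add: n_def)
  from assms obtain u where u: "T.awalk u p u" "distinct (tl (pawalk_verts u p))" "p \<noteq> []"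
    unfolding T.cycle_def by auto
  have arcs: "set p \<subseteq> parcs T" and cas: "pcas u p u"
    using u(1) by (auto simp: T.awalk_def)
  have dist: "distinct (map snd p)"
    using T.awalk_verts_conv'[OF cas] u(2,3) by simp
  have "snd (last p) = u"
    using u(1,3) T.awlast_if_cas[OF cas] T.awalk_verts_conv'[OF cas] by (simp add: last_map)
  then have prev: "fst (p ! i) = snd (p ! (if i = 0 then n - 1 else i - 1))" if "i < n" for i
    using walk_consecutive[OF cas, of i] that u(3) by (auto simp: n_def last_conv_nth)
  obtain i where i: "i < n" and max: "\<And>j. j < n \<Longrightarrow> dep (snd (p ! j)) \<le> dep (snd (p ! i))"
  proof -
    define M where "M = Max ((\<lambda>j. dep (snd (p ! j))) ` {..<n})"
    have "M \<in> (\<lambda>j. dep (snd (p ! j))) ` {..<n}"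
      unfolding M_def using n by (intro Max_in) (auto simp: lessThan_empty_iff)
    then obtain i where i: "i < n" "M = dep (snd (p ! i))" by auto
    have "dep (snd (p ! j)) \<le> M" if "j < n" for j
      unfolding M_def using that by (intro Max_ge) auto
    with i that show ?thesis by blast
  qed
  define j where "j = (if i = n - 1 then 0 else i + 1)"
  define l where "l = (if i = 0 then n - 1 else i - 1)"
  \<comment> \<open>The cyclic successor \<open>j\<close> and predecessor \<open>l\<close> of
    \<open>i\<close> differ because the cycle has at least three arcs.\<close>
  have jl: "j < n" "l < n" "j \<noteq> l" using i n by (auto simp: j_def l_def split: if_splits)
  define m where "m = snd (p ! i)"
  have "p ! i = (snd (p ! l), m)"
    using prev[OF i] by (simp add: l_def m_def prod_eq_iff)
  then have in_arc: "(snd (p ! l), m) \<in> parcs T"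
    using arcs i by (metis n_def nth_mem subsetD)
  have "p ! j = (m, snd (p ! j))"
    using prev[OF jl(1)] i n by (auto simp: j_def m_def prod_eq_iff split: if_splits)
  then have out_arc: "(m, snd (p ! j)) \<in> parcs T"
    using arcs jl(1) by (metis n_def nth_mem subsetD)
  have "dep (snd (p ! l)) \<le> dep m" "dep (snd (p ! j)) \<le> dep m"
    using max jl by (auto simp: m_def)
  \<comment> \<open>A neighbor of \<open>m\<close> that is not its parent is a child and would be
    deeper than \<open>m\<close>.\<close>
  then have "snd (p ! l) = par m" "snd (p ! j) = par m"
    using in_arc out_arc by (auto simp: parcs_T_iff dep_par)
  then show False
    using dist jl unfolding distinct_conv_nth n_def by (metis length_map nth_map)
qed

lemma undirected_tree_T: "undirected_tree T"
  unfolding undirected_tree_def using T.pair_graph connected_T no_long_cycle by fastforce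

text \<open>The agent moves along one arc per step, so it cannot reach depth \<open>D\<close> before
  time \<open>D\<close>.\<close>

lemma dep_run_le:
  assumes "port_labeling T \<pi>" "valid_algorithm A" "\<And>u. u \<in> V \<Longrightarrow> node_degree T u > 0"
  shows "dep (fst (run T \<pi> A P r t n)) \<le> n"
proof (induction n)
  case (Suc n)
  have "(fst (run T \<pi> A P r t n), fst (run T \<pi> A P r t (Suc n))) \<in> parcs T"
    using assms root_in by (intro T.run_walk) auto
  from dep_arc[OF this] Suc show ?case by linarith
qed (simp add: dep_root)

end

section \<open>The regular tree\<close>

text \<open>
  Breadth-first numbering of the infinite \<open>(d + 1)\<close>-regular tree: the root \<open>0\<close> has the children
  \<open>1, \<dots>, d + 1\<close>, and \<open>u > 0\<close> has the children \<open>u d + 2, \<dots>, u d + d + 1\<close>. Truncated subtraction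
  makes \<open>0\<close> the parent of \<open>1\<close>.
\<close>

definition bfs_parent :: "nat \<Rightarrow> nat \<Rightarrow> nat" where
  "bfs_parent d v = (v - 2) div d"

lemma bfs_parent_less: "v > 0 \<Longrightarrow> bfs_parent d v < v"
  unfolding bfs_parent_def by (rule le_less_trans[OF div_le_dividend]) simp

function bfs_depth :: "nat \<Rightarrow> nat \<Rightarrow> nat" where
  "bfs_depth d v = (if v = 0 then 0 else Suc (bfs_depth d (bfs_parent d v)))"
  by auto
termination by (relation "measure snd") (auto simp: bfs_parent_less)

declare bfs_depth.simps [simp del]

lemma bfs_depth_0 [simp]: "bfs_depth d 0 = 0"
  by (simp add: bfs_depth.simps)

lemma bfs_depth_pos: "v > 0 \<Longrightarrow> bfs_depth d v = Suc (bfs_depth d (bfs_parent d v))"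
  by (subst bfs_depth.simps) simp

lemma bfs_depth_eq_0_iff [simp]: "bfs_depth d v = 0 \<longleftrightarrow> v = 0"
  using bfs_depth_pos by (cases "v = 0") auto

lemma bfs_children:
  assumes "d > 0"
  shows "{v. v > 0 \<and> bfs_parent d v = u} = (if u = 0 then {1..<d + 2} else {u * d + 2..<u * d + 2 + d})"
proof -
  have iff: "bfs_parent d v = u \<longleftrightarrow> u * d \<le> v - 2 \<and> v - 2 < u * d + d" for v
    unfolding bfs_parent_def using assms
    by (metis (no_types) add.commute div_nat_eqI dividend_less_div_times div_times_less_eq_dividend mult.commute mult_Suc)
  show ?thesis
  proof (cases "u = 0")
    case True
    then show ?thesis using assms unfolding iff by auto
  next
    case False
    \<comment> \<open>Here \<open>v - 2\<close> is positive, so truncation has no effect; only for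
      \<open>u = 0\<close> does it admit the extra child \<open>1\<close>.\<close>
    then have "u * d > 0" using assms by simp
    then have "v > 0 \<and> u * d \<le> v - 2 \<and> v - 2 < u * d + d \<longleftrightarrow> v \<in> {u * d + 2..<u * d + 2 + d}" for v
      unfolding atLeastLessThan_iff by linarith
    then show ?thesis using False unfolding iff by (simp only: if_False Collect_mem_eq)
  qed
qed

lemma finite_bfs_children: "d > 0 \<Longrightarrow> finite {v. v > 0 \<and> bfs_parent d v = u}"
  by (simp add: bfs_children)

lemma card_bfs_children:
  "d > 0 \<Longrightarrow> card {v. v > 0 \<and> bfs_parent d v = u} = (if u = 0 then d + 1 else d)"
  by (simp add: bfs_children)

lemma bfs_level_Suc:
  "{v. bfs_depth d v = Suc i} = (\<Union>u\<in>{u. bfs_depth d u = i}. {v. v > 0 \<and> bfs_parent d v = u})"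
proof -
  have "bfs_depth d v = Suc i \<longleftrightarrow> v > 0 \<and> bfs_depth d (bfs_parent d v) = i" for v
    by (cases "v = 0") (auto simp: bfs_depth_pos)
  then show ?thesis by auto
qed

text \<open>Each level is the disjoint union of the child sets of the previous one, and every node
  has at least \<open>d\<close> children. The bound ignores the extra child of the root and so also
  fits level 0.\<close>

lemma bfs_level:
  assumes "d > 0"
  shows "finite {v. bfs_depth d v = i} \<and> d ^ i \<le> card {v. bfs_depth d v = i}"
proof (induction i)
  case (Suc i)
  have "d * d ^ i \<le> (\<Sum>u\<in>{u. bfs_depth d u = i}. d)"
    using Suc by (simp add: mult.commute)
  also have "\<dots> \<le> (\<Sum>u\<in>{u. bfs_depth d u = i}. card {v. v > 0 \<and> bfs_parent d v = u})"
    using assms by (intro sum_mono) (auto simp: card_bfs_children)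
  also have "\<dots> = card {v. bfs_depth d v = Suc i}"
    unfolding bfs_level_Suc using Suc assms
    by (intro card_UN_disjoint[symmetric]) (auto simp: finite_bfs_children simp del: neq0_conv)
  finally show ?case
    using Suc assms by (auto simp: bfs_level_Suc finite_bfs_children simp del: neq0_conv)
qed simp

lemma finite_bfs_ball: "d > 0 \<Longrightarrow> finite {v. bfs_depth d v \<le> D}"
proof -
  assume "d > 0"
  moreover have "{v. bfs_depth d v \<le> D} = (\<Union>i\<le>D. {v. bfs_depth d v = i})" by auto
  ultimately show ?thesis using bfs_level by simp
qed

lemma parent_tree_bfs:
  assumes "d > 0"
  shows "parent_tree {v. bfs_depth d v \<le> D} 0 (bfs_parent d) (bfs_depth d)"
  using assms by unfold_locales (auto simp: finite_bfs_ball bfs_depth_pos)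

section \<open>The lower bound\<close>

text \<open>A base above 1 only grows when the exponent is raised to 1, giving at most
  \<open>k / e\<close>; a base up to 1 gives at most 1. The factor \<open>k + 1\<close> from the
  binomial estimate thus absorbs this term.\<close>

lemma powr_fraction_le:
  "(if k = 0 then 1 else (real k / exp 1) powr (real k / real (k + 1))) \<le> real (k + 1)"
proof (cases "real k / exp 1 \<le> 1")
  case True
  then have "(real k / exp 1) powr (real k / real (k + 1)) \<le> 1"
    by (intro powr_le1) auto
  then show ?thesis by simp
next
  case False
  then have "(real k / exp 1) powr (real k / real (k + 1)) \<le> (real k / exp 1) powr 1"
    by (intro powr_mono) auto
  also have "\<dots> \<le> real k"
    by (simp add: field_simps mult_le_cancel_left1)
  finally show ?thesis by simp
qed

text \<open>Taking \<open>m\<close>-th roots of the counting inequality isolates the time bound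
  \<open>x\<close>.\<close>

lemma root_bound:
  assumes "m \<ge> 1" "0 < d" "0 \<le> x" "d ^ D \<le> (exp 1 * x / real m) ^ m"
  shows "real m * d powr (real D / real m) \<le> exp 1 * x"
proof -
  have "d powr (real D / real m) = (d ^ D) powr (1 / real m)"
    using assms by (simp add: powr_powr flip: powr_realpow)
  also have "\<dots> \<le> ((exp 1 * x / real m) ^ m) powr (1 / real m)"
    using assms by (intro powr_mono2) auto
  also have "\<dots> = exp 1 * x / real m"
    using assms by (cases "x = 0") (auto simp: powr_powr simp flip: powr_realpow)
  finally show ?thesis using assms by (simp add: field_simps)
qed

theorem theorem4:
  shows "\<exists>C::real. C > 0 \<and>
    (\<forall>\<Delta> D k :: nat. \<Delta> \<ge> 2 \<longrightarrow> D \<ge> 1 \<longrightarrow> k < D \<longrightarrow>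
      (\<exists>(T :: nat pair_pre_digraph) (\<pi> :: nat \<Rightarrow> nat \<Rightarrow> nat) (r :: nat).
        undirected_tree T \<and> port_labeling T \<pi> \<and> r \<in> pverts T \<and>
        height T r = ereal (real D) \<and> max_degree T = \<Delta> \<and>
        (\<forall>(A :: algorithm) (L :: nat \<Rightarrow> nat set).
          valid_algorithm A \<longrightarrow> pebble_strategy T r D k L \<longrightarrow>
          (\<exists>t\<in>pverts T. hop_dist T r t = ereal (real D) \<and>
            ereal_of_enat (hunt_time T \<pi> A (L t) r t) \<ge>
              ereal (C * (if k = 0 then 1 else (real k / exp 1) powr (real k / real (k + 1)))
                       * (real \<Delta> - 1) powr (real D / real (k + 1)))))))"
\<comment> \<open>The factor \<open>exp 1\<close> comes from the binomial estimate, the factor 2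
  pays for rounding the bound up to an integer.\<close>
proof (intro exI[of _ "1 / (2 * exp 1)"] conjI allI impI)
  fix \<Delta> D k :: nat
  assume "\<Delta> \<ge> 2" "D \<ge> 1" "k < D"
  define d where "d = \<Delta> - 1"
  have d: "d > 0" "\<Delta> = d + 1" using \<open>\<Delta> \<ge> 2\<close> by (auto simp: d_def)
  define V where "V = {v. bfs_depth d v \<le> D}"
  interpret parent_tree V 0 "bfs_parent d" "bfs_depth d"
    unfolding V_def using d(1) by (rule parent_tree_bfs)
  obtain \<pi> where \<pi>: "port_labeling T \<pi>" using T.ex_port_labeling by blast
  define X where "X = {v. bfs_depth d v = D}"
  have X: "finite X" "d ^ D \<le> card X" using bfs_level[OF d(1), of D] by (auto simp: X_def)
  have "X \<noteq> {}" using X d(1) by auto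
  then have depth: "Max (bfs_depth d ` V) = D"
    using finite_V by (intro Max_eqI) (auto simp: V_def X_def)
  have children: "card {v \<in> V. v \<noteq> 0 \<and> bfs_parent d v = u} \<le> (if u = 0 then d + 1 else d)" for u
    unfolding card_bfs_children[OF d(1), symmetric] using d(1)
    by (intro card_mono) (auto simp: finite_bfs_children simp del: neq0_conv)
  \<comment> \<open>Cutting at depth \<open>D \<ge> 1\<close> keeps all children of the root, so the
    root attains the maximum degree.\<close>
  have "{v \<in> V. v \<noteq> 0 \<and> bfs_parent d v = 0} = {v. v > 0 \<and> bfs_parent d v = 0}"
    using \<open>D \<ge> 1\<close> by (auto simp: V_def bfs_depth_pos)
  then have deg_root: "node_degree T 0 = d + 1"
    using d(1) root_in by (simp add: node_degree_T card_bfs_children)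
  have "node_degree T u \<le> d + 1" if "u \<in> V" for u
    using children[of u] that by (auto simp: node_degree_T split: if_splits)
  then have max_deg: "max_degree T = \<Delta>"
    unfolding max_degree_def using finite_V root_in deg_root d(2)
    by (intro Max_eqI) (auto intro: rev_image_eqI)
  have deg_pos: "node_degree T u > 0" if "u \<in> V" for u
    using that deg_root by (cases "u = 0") (auto simp: node_degree_T)
  show "\<exists>(T :: nat pair_pre_digraph) \<pi> r.
      undirected_tree T \<and> port_labeling T \<pi> \<and> r \<in> pverts T \<and>
      height T r = ereal (real D) \<and> max_degree T = \<Delta> \<and>
      (\<forall>(A :: algorithm) (L :: nat \<Rightarrow> nat set).
        valid_algorithm A \<longrightarrow> pebble_strategy T r D k L \<longrightarrow>
        (\<exists>t\<in>pverts T. hop_dist T r t = ereal (real D) \<and>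
          ereal_of_enat (hunt_time T \<pi> A (L t) r t) \<ge>
            ereal (1 / (2 * exp 1) * (if k = 0 then 1 else (real k / exp 1) powr (real k / real (k + 1)))
                     * (real \<Delta> - 1) powr (real D / real (k + 1)))))"
  proof (intro exI[of _ T] exI[of _ \<pi>] exI[of _ "0 :: nat"] conjI allI impI)
    fix A :: algorithm and L :: "nat \<Rightarrow> nat set"
    assume A: "valid_algorithm A" and L: "pebble_strategy T 0 D k L"
    define \<beta> where "\<beta> = 1 / (2 * exp 1) * (if k = 0 then 1 else (real k / exp 1) powr (real k / real (k + 1)))
      * (real \<Delta> - 1) powr (real D / real (k + 1))"
    have XV: "t \<in> V" "hop_dist T 0 t = ereal (real D)" if "t \<in> X" for t
      using that hop_dist_root[of t] by (auto simp: X_def V_def)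
    have L': "finite (L t) \<and> card (L t) \<le> k" if "t \<in> X" for t
      using L XV[OF that] finite_V by (auto simp: pebble_strategy_def intro: finite_subset)
    have "\<exists>t\<in>X. ereal \<beta> \<le> ereal_of_enat (hunt_time T \<pi> A (L t) 0 t)"
    proof (rule ccontr)
      assume neg: "\<not> ?thesis"
      \<comment> \<open>Finding times are integers, so a time below \<open>\<beta>\<close> is below
        its ceiling \<open>n\<close>.\<close>
      define n where "n = nat \<lceil>\<beta>\<rceil>"
      have "\<beta> \<ge> 0" by (simp add: \<beta>_def)
      then have n: "\<beta> \<le> real n" "real n < \<beta> + 1" unfolding n_def by linarith+
      have found: "\<exists>i<n. fst (run T \<pi> A (L t) 0 t i) = t" if "t \<in> X" for t
      proof -
        have "\<not> enat n \<le> hunt_time T \<pi> A (L t) 0 t"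
        proof
          assume "enat n \<le> hunt_time T \<pi> A (L t) 0 t"
          then have "ereal_of_enat (enat n) \<le> ereal_of_enat (hunt_time T \<pi> A (L t) 0 t)"
            by (simp only: ereal_of_enat_le_iff)
          moreover have "ereal \<beta> \<le> ereal_of_enat (enat n)" using n(1) by simp
          ultimately show False using neg that by (meson order_trans)
        qed
        then show ?thesis by (simp add: hunt_time_less_iff not_le)
      qed
      obtain t where "t \<in> X" using \<open>X \<noteq> {}\<close> by blast
      with found obtain i where i: "i < n" "fst (run T \<pi> A (L t) 0 t i) = t" by blast
      \<comment> \<open>This gives \<open>k + 1 \<le> D < n\<close>, as the binomial estimate
        requires, and \<open>n \<ge> 2\<close> for the final contradiction.\<close>
      have "D \<le> i"
        using dep_run_le[OF \<pi> A deg_pos, of "L t" t i] i(2) \<open>t \<in> X\<close> by (simp add: X_def)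
      then have Dn: "D < n" using i(1) by simp
      have "real d ^ D \<le> real (card X)"
        using X(2) by (simp flip: of_nat_power)
      also have "\<dots> \<le> real (\<Sum>i\<le>k + 1. n choose i)"
        using card_targets_le[of X L k n, OF L' found] by (simp only: of_nat_le_iff)
      also have "\<dots> \<le> (exp 1 * real n / real (k + 1)) ^ (k + 1)"
        using Dn \<open>k < D\<close> by (intro sum_choose_le_exp) auto
      finally have root: "real (k + 1) * real d powr (real D / real (k + 1)) \<le> exp 1 * real n"
        using d(1) by (intro root_bound) auto
      have "\<beta> * (2 * exp 1) =
          (if k = 0 then 1 else (real k / exp 1) powr (real k / real (k + 1))) * real d powr (real D / real (k + 1))"
        unfolding \<beta>_def d(2) by simp
      also have "\<dots> \<le> real (k + 1) * real d powr (real D / real (k + 1))"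
        by (intro mult_right_mono powr_fraction_le) simp
      also note root
      finally have "\<beta> \<le> real n / 2" by simp
      \<comment> \<open>From \<open>\<beta> \<le> n / 2\<close> and \<open>n < \<beta> + 1\<close>
        follows \<open>n < 2\<close>, whereas \<open>n > D \<ge> 1\<close>.\<close>
      then show False using n(2) Dn \<open>D \<ge> 1\<close> by simp
    qed
    then show "\<exists>t\<in>pverts T. hop_dist T 0 t = ereal (real D) \<and>
        ereal_of_enat (hunt_time T \<pi> A (L t) 0 t) \<ge>
          ereal (1 / (2 * exp 1) * (if k = 0 then 1 else (real k / exp 1) powr (real k / real (k + 1)))
                   * (real \<Delta> - 1) powr (real D / real (k + 1)))"
      unfolding \<beta>_def using XV by (metis pverts_T)
  qed (use undirected_tree_T \<pi> root_in height_T depth max_deg in auto)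
qed simp

end
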